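(* Let $f:\mathbb{R}^n\to\mathbb{R}^n$ be a polynomial map and let $\mathbb{X}\subset\mathbb{R}^n$ be a compact basic semialgebraic set, $\mathbb{X}=\{x\in\mathbb{R}^n : \varphi_0(x)\ge 0\}$ with $\varphi_0:\mathbb{R}^n\to\mathbb{R}^m$ a polynomial map. For a set $X\subseteq\mathbb{R}^n$ put $F^{-1}_{\mathbb{X}}(X)=\{x\in\mathbb{X} : f(x)\in X\}$. Then for every basic semialgebraic set $X$ in $\mathbb{R}^n$, the set $F^{-1}_{\mathbb{X}}(X)$ is a basic semialgebraic set in $\mathbb{R}^n$.
   Context: A map $g:\mathbb{R}^n\to\mathbb{R}^p$ is polynomial if each of its components is a polynomial in $n$ variables with real coefficients. Inequalities between vectors are componentwise. A set $X\subseteq\mathbb{R}^n$ is basic semialgebraic if it is the solution set of a finite number of polynomial inequalities, i.e. $X=\{x\in\mathbb{R}^n : \varphi(x)\ge 0\}$ for some polynomial map $\varphi:\mathbb{R}^n\to\mathbb{R}^p$ and some $p$. *)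

theory Defs
  imports "HOL-Analysis.Analysis"
begin

text \<open>
  Polynomial maps are rendered by the library constant \<^const>\<open>polynomial_function\<close>.
  On \<open>real ^ 'n\<close> the bounded linear functionals are the linear forms in the coordinates,
  so \<^const>\<open>real_polynomial_function\<close> describes the functions given by polynomials in the
  coordinates with real coefficients. A map into \<open>real ^ 'p\<close> is polynomial iff its components are:
\<close>

lemma polynomial_function_iff_components:
  fixes g :: "real ^ 'n \<Rightarrow> real ^ 'p"
  shows "polynomial_function g \<longleftrightarrow> (\<forall>i. real_polynomial_function (\<lambda>x. g x $ i))"
  unfolding polynomial_function_iff_Basis_inner
  by (auto simp: Basis_vec_def inner_axis)

text \<open>
  The number \<open>p\<close> of inequalities is existentially quantified, so the polynomial map into
  \<open>\<real>\<^sup>p\<close> is represented by the family of its components \<open>\<phi> 0, \<dots>, \<phi> (p - 1)\<close>. The case \<open>p = 0\<close>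
  yields the whole space, which is also the solution set of the single inequality \<open>0 \<ge> 0\<close>.
\<close>

definition basic_semialgebraic :: "(real ^ 'n) set \<Rightarrow> bool" where
  "basic_semialgebraic X \<longleftrightarrow>
     (\<exists>(p::nat) (\<phi> :: nat \<Rightarrow> real ^ 'n \<Rightarrow> real).
        (\<forall>i<p. real_polynomial_function (\<phi> i)) \<and> X = {x. \<forall>i<p. \<phi> i x \<ge> 0})"

definition preimage_within :: "('a \<Rightarrow> 'b) \<Rightarrow> 'a set \<Rightarrow> 'b set \<Rightarrow> 'a set" where
  "preimage_within f S X = {x \<in> S. f x \<in> X}"

end

theory Submission
  imports Defs
begin

text \<open>
  Membership in \<open>preimage_within f XX X\<close> is the conjunction of \<open>x \<in> XX\<close> and \<open>f x \<in> X\<close>. Each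
  conjunct is a finite system of polynomial inequalities: the first is given by \<open>\<phi>\<^sub>0\<close>, and the second
  arises by substituting \<open>f\<close> into the inequalities of \<open>X\<close>, since polynomials are closed under
  composition. Joining the two systems describes the preimage. Both operations are transparent once
  a system is a finite set of polynomials, which avoids renumbering the inequalities: substitution
  is then an image (\<open>basic_semialgebraic_vimage\<close>) and joining a union (\<open>basic_semialgebraic_Int\<close>).
\<close>

lemma basic_semialgebraic_iff_finite_set:
  fixes X :: "(real ^ 'n) set"
  shows "basic_semialgebraic X \<longleftrightarrow>
    (\<exists>P. finite P \<and> (\<forall>p\<in>P. real_polynomial_function p) \<and> X = {x. \<forall>p\<in>P. 0 \<le> p x})"
proof
  assume "basic_semialgebraic X"
  then obtain k and \<phi> :: "nat \<Rightarrow> real ^ 'n \<Rightarrow> real"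
    where "\<forall>i<k. real_polynomial_function (\<phi> i)" "X = {x. \<forall>i<k. 0 \<le> \<phi> i x}"
    unfolding basic_semialgebraic_def by blast
  then show "\<exists>P. finite P \<and> (\<forall>p\<in>P. real_polynomial_function p) \<and> X = {x. \<forall>p\<in>P. 0 \<le> p x}"
    by (intro exI[of _ "\<phi> ` {..<k}"]) auto
next
  assume "\<exists>P. finite P \<and> (\<forall>p\<in>P. real_polynomial_function p) \<and> X = {x. \<forall>p\<in>P. 0 \<le> p x}"
  then obtain P where P: "finite P" "\<forall>p\<in>P. real_polynomial_function p" "X = {x. \<forall>p\<in>P. 0 \<le> p x}"
    by blast
  obtain k :: nat and \<phi> where "P = \<phi> ` {i. i < k}"
    using finite_imp_nat_seg_image_inj_on[OF P(1)] by blast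
  then show "basic_semialgebraic X"
    unfolding basic_semialgebraic_def using P(2,3)
    by (intro exI[of _ k] exI[of _ \<phi>]) auto
qed

lemma basic_semialgebraic_Int:
  assumes "basic_semialgebraic X" "basic_semialgebraic Y"
  shows "basic_semialgebraic (X \<inter> Y)"
proof -
  obtain P Q where
    "finite P" "\<forall>p\<in>P. real_polynomial_function p" "X = {x. \<forall>p\<in>P. 0 \<le> p x}"
    "finite Q" "\<forall>p\<in>Q. real_polynomial_function p" "Y = {x. \<forall>p\<in>Q. 0 \<le> p x}"
    using assms unfolding basic_semialgebraic_iff_finite_set by blast
  then show ?thesis
    unfolding basic_semialgebraic_iff_finite_set by (intro exI[of _ "P \<union> Q"]) auto
qed

lemma basic_semialgebraic_vimage:
  fixes f :: "real ^ 'n \<Rightarrow> real ^ 'k"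
  assumes "polynomial_function f" "basic_semialgebraic X"
  shows "basic_semialgebraic (f -` X)"
proof -
  obtain P where
    "finite P" "\<forall>p\<in>P. real_polynomial_function p" "X = {x. \<forall>p\<in>P. 0 \<le> p x}"
    using assms(2) unfolding basic_semialgebraic_iff_finite_set by blast
  then show ?thesis
    unfolding basic_semialgebraic_iff_finite_set
    by (intro exI[of _ "(\<lambda>p. p \<circ> f) ` P"])
      (auto intro: real_polynomial_function_compose[OF assms(1)])
qed

lemma basic_semialgebraic_nonneg:
  fixes \<phi> :: "real ^ 'n \<Rightarrow> real ^ 'm"
  assumes "polynomial_function \<phi>"
  shows "basic_semialgebraic {x. 0 \<le> \<phi> x}"
  unfolding basic_semialgebraic_iff_finite_set
  using assms[unfolded polynomial_function_iff_components]
  by (intro exI[of _ "range (\<lambda>i x. \<phi> x $ i)"]) (auto simp: less_eq_vec_def)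

theorem theorem6:
  fixes f :: "real ^ 'n \<Rightarrow> real ^ 'n"
    and \<phi>\<^sub>0 :: "real ^ 'n \<Rightarrow> real ^ 'm"
    and XX :: "(real ^ 'n) set"
  assumes "polynomial_function f"
    and "polynomial_function \<phi>\<^sub>0"
    and "XX = {x. \<phi>\<^sub>0 x \<ge> 0}"
    and "compact XX"
  shows "\<forall>X :: (real ^ 'n) set. basic_semialgebraic X \<longrightarrow> basic_semialgebraic (preimage_within f XX X)"
proof (intro allI impI)
  fix X :: "(real ^ 'n) set"
  assume "basic_semialgebraic X"
  then have "basic_semialgebraic (XX \<inter> f -` X)"
    unfolding assms(3)
    by (intro basic_semialgebraic_Int basic_semialgebraic_nonneg basic_semialgebraic_vimage assms)
  moreover have "preimage_within f XX X = XX \<inter> f -` X"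
    by (auto simp: preimage_within_def)
  ultimately show "basic_semialgebraic (preimage_within f XX X)"
    by simp
qed

end
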